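(* Let $q$ be a power of a prime $p$ and let $n,d\in\mathbb{Z}_{\geq 1}$. Then \[ \Delta_d(q^n-1,q^n+1)=-\sum_{j=1}^{\frac{q^n+q-2}{q-1}}S_d\Bigl(2+(j-1)(q-1),\,2q^n-2-(j-1)(q-1)\Bigr). \]
   Context: $\mathbb{F}_q$ is the finite field with $q$ elements, $A=\mathbb{F}_q[t]$, and $A_{d+}$ is the set of monic polynomials in $A$ of degree $d$. For $s\in\mathbb{Z}$ and $d\in\mathbb{Z}_{\geq0}$, $S_d(s)=\sum_{a\in A_{d+}}a^{-s}\in\mathbb{F}_q(t)$. For $s_1,s_2\in\mathbb{Z}_{>0}$ and $d\in\mathbb{Z}_{\geq 0}$, $S_d(s_1,s_2)=S_d(s_1)\sum_{d>d_2\geq 0}S_{d_2}(s_2)$. For $a,b\in\mathbb{Z}_{>0}$, $\Delta_d(a,b)=S_d(a)S_d(b)-S_d(a+b)$. *)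

theory Defs
  imports "HOL-Computational_Algebra.Computational_Algebra" "HOL-Library.Cardinality"
begin

text \<open>
  The finite field with \<open>q\<close> elements is a type \<open>'a :: {field, finite}\<close> with \<open>CARD('a) = q\<close>;
  then \<open>A\<close> is \<open>'a poly\<close> and its field of fractions is \<open>'a poly fract\<close>.
\<close>

definition monics :: "nat \<Rightarrow> 'a::{field,finite} poly set" where
  "monics d = {a. lead_coeff a = 1 \<and> degree a = d}"

text \<open>The power sums below therefore range over a finite set.\<close>

lemma finite_monics: "finite (monics d :: 'a::{field,finite} poly set)"
proof (rule finite_subset)
  show "monics d \<subseteq> Poly ` {xs :: 'a list. set xs \<subseteq> UNIV \<and> length xs = Suc d}"
  proof
    fix a :: "'a poly" assume "a \<in> monics d"
    then have "a \<noteq> 0" "degree a = d" by (auto simp: monics_def)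
    then have "length (coeffs a) = Suc d" by (simp add: length_coeffs_degree)
    then show "a \<in> Poly ` {xs. set xs \<subseteq> UNIV \<and> length xs = Suc d}"
      by (intro image_eqI[of _ _ "coeffs a"]) simp_all
  qed
  show "finite (Poly ` {xs :: 'a list. set xs \<subseteq> UNIV \<and> length xs = Suc d})"
    by (intro finite_imageI finite_lists_length_eq) simp
qed

definition S :: "nat \<Rightarrow> int \<Rightarrow> 'a::{field,finite} poly fract" where
  "S d s = (\<Sum>a\<in>monics d. to_fract a powi (- s))"

text \<open>\<open>S2\<close> and \<open>\<Delta>\<close> are used only at positive integers; taking the arguments in \<open>int\<close>
  avoids truncated subtraction.\<close>

definition S2 :: "nat \<Rightarrow> int \<Rightarrow> int \<Rightarrow> 'a::{field,finite} poly fract" where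
  "S2 d s1 s2 = S d s1 * (\<Sum>d2<d. S d2 s2)"

definition \<Delta> :: "nat \<Rightarrow> int \<Rightarrow> int \<Rightarrow> 'a::{field,finite} poly fract" where
  "\<Delta> d a b = S d a * S d b - S d (a + b)"

end

theory Submission
  imports Defs
begin

text \<open>
  Write \<open>Q = q ^ n\<close>. Expanding the product, \<open>\<Delta> d (Q - 1) (Q + 1)\<close> is the sum of
  \<open>x\<^sup>1\<^sup>-\<^sup>Q y\<^sup>-\<^sup>Q\<^sup>-\<^sup>1\<close> over pairs \<open>x \<noteq> y\<close> of monic polynomials of degree \<open>d\<close>. The difference
  \<open>z = x - y\<close> runs independently of \<open>x\<close>, and also independently of \<open>y\<close>, over the nonzero
  polynomials of degree less than \<open>d\<close>. Since \<open>x\<^sup>Q = y\<^sup>Q + z\<^sup>Q\<close>, the partial fraction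
  decomposition of the summand has coefficients \<open>0\<close> and \<open>\<plusminus>1\<close> only, so that no binomial
  coefficients have to be reduced modulo \<open>p\<close>. Finally \<open>z = c m\<close> with \<open>c\<close> a nonzero constant and
  \<open>m\<close> monic, and the sum of \<open>c\<^sup>-\<^sup>k\<close> over \<open>c\<close> is \<open>-1\<close> if \<open>q - 1\<close> divides \<open>k\<close> and \<open>0\<close> otherwise.
\<close>

section \<open>Power sums over a finite field\<close>

text \<open>Translation by 1 permutes the field, so the sum of all elements does not change when
  \<open>CARD('a)\<close> ones are added to it.\<close>

lemma of_nat_card_finite_field: "of_nat CARD('a) = (0::'a::{field,finite})"
proof -
  have "(\<Sum>x\<in>UNIV. x) = (\<Sum>x\<in>UNIV. x + 1 :: 'a)"
    by (rule sum.reindex_bij_witness[of _ "\<lambda>x. x + 1" "\<lambda>x. x - 1"]) auto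
  then show ?thesis
    by (simp add: sum.distrib)
qed

text \<open>Multiplication by \<open>c\<close> permutes the nonzero elements, and their product is
  nonzero, so it cancels.\<close>

lemma power_card_minus_1_finite_field:
  fixes c :: "'a::{field,finite}"
  assumes "c \<noteq> 0"
  shows "c ^ (CARD('a) - 1) = 1"
proof -
  have "(\<Prod>x\<in>UNIV - {0::'a}. x) = (\<Prod>x\<in>UNIV - {0}. c * x)"
    by (rule prod.reindex_bij_witness[of _ "\<lambda>x. c * x" "\<lambda>x. x / c"]) (use assms in auto)
  also have "\<dots> = c ^ (CARD('a) - 1) * (\<Prod>x\<in>UNIV - {0}. x)"
    by (simp add: prod.distrib card_Diff_singleton)
  finally show ?thesis
    by simp
qed

text \<open>If the divisibility holds, all \<open>CARD('a) - 1\<close> summands are 1. Otherwise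
  some nonzero \<open>c\<close> has \<open>c ^ k \<noteq> 1\<close>; scaling the variable by
  \<open>c\<close> multiplies the sum by \<open>c ^ k\<close>, so it vanishes.\<close>

lemma sum_nonzero_powers_finite_field:
  "(\<Sum>c\<in>UNIV - {0::'a::{field,finite}}. c ^ k) = (if CARD('a) - 1 dvd k then -1 else 0)"
proof (cases "CARD('a) - 1 dvd k")
  case True
  then obtain l where k: "k = (CARD('a) - 1) * l" ..
  have "(\<Sum>c\<in>UNIV - {0::'a}. c ^ k) = (\<Sum>c\<in>UNIV - {0::'a}. 1)"
    by (rule sum.cong) (auto simp: k power_mult power_card_minus_1_finite_field
      simp del: One_nat_def)
  then have "(\<Sum>c\<in>UNIV - {0::'a}. c ^ k) = of_nat (CARD('a) - 1)"
    by (simp add: card_Diff_singleton)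
  moreover have "CARD('a) \<ge> 1"
    by (simp add: Suc_leI)
  ultimately show ?thesis
    using True of_nat_card_finite_field[where ?'a = 'a] by (simp add: of_nat_diff)
next
  case False
  \<comment> \<open>Reducing the exponent makes root counting conclusive:
    \<open>monom 1 r - 1\<close> has at most \<open>r < CARD('a) - 1\<close> roots, so some nonzero
    element is not a root.\<close>
  define r where "r = k mod (CARD('a) - 1)"
  have card: "card (UNIV - {0::'a}) = CARD('a) - 1"
    by (simp add: card_Diff_singleton)
  have r: "0 < r"
    using False by (simp add: r_def mod_greater_zero_iff_not_dvd)
  have pos: "CARD('a) - 1 > 0"
    using card finite_UNIV_card_ge_0[where ?'a = 'a] card_gt_0_iff[of "UNIV - {0::'a}"]
    by (metis DiffI UNIV_I empty_iff finite_class.finite_UNIV finite_Diff one_neq_zero singletonD)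
  have pow: "c ^ k = c ^ r" if "c \<noteq> 0" for c :: 'a
  proof -
    have "c ^ k = c ^ ((CARD('a) - 1) * (k div (CARD('a) - 1)) + r)"
      by (simp add: r_def)
    then show ?thesis
      by (simp only: power_add power_mult power_card_minus_1_finite_field[OF that]) simp
  qed
  have "\<exists>c::'a. c \<noteq> 0 \<and> c ^ r \<noteq> 1"
  proof (rule ccontr)
    assume "\<not> ?thesis"
    then have sub: "UNIV - {0} \<subseteq> {c::'a. poly (monom 1 r - 1) c = 0}"
      by (auto simp: poly_monom)
    have deg: "degree (monom 1 r - 1 :: 'a poly) = r"
      using r degree_add_eq_left[of "-1" "monom 1 r :: 'a poly"] by (simp add: degree_monom_eq)
    then have "monom 1 r - 1 \<noteq> (0 :: 'a poly)"
      using r by auto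
    then have "card {c::'a. poly (monom 1 r - 1) c = 0} \<le> r"
      using card_poly_roots_bound deg by metis
    then have "CARD('a) - 1 \<le> r"
      using card card_mono[OF _ sub] by simp
    then show False
      using mod_less_divisor[OF pos, of k] unfolding r_def by simp
  qed
  then obtain c :: 'a where c: "c \<noteq> 0" "c ^ k \<noteq> 1"
    using pow by auto
  have "(\<Sum>x\<in>UNIV - {0::'a}. x ^ k) = (\<Sum>x\<in>UNIV - {0}. (c * x) ^ k)"
    by (rule sum.reindex_bij_witness[of _ "\<lambda>x. c * x" "\<lambda>x. x / c"]) (use c in auto)
  also have "\<dots> = c ^ k * (\<Sum>x\<in>UNIV - {0}. x ^ k)"
    by (simp add: power_mult_distrib sum_distrib_left)
  finally show ?thesis
    using False c by simp
qed

section \<open>Power sums over polynomials of bounded degree\<close>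

lemma to_fract_power: "to_fract (a ^ k) = to_fract a ^ k"
  by (induction k) simp_all

lemma S_of_nat: "S d (int k) = (\<Sum>a\<in>monics d. inverse (to_fract a) ^ k)"
  by (simp add: S_def power_int_minus power_inverse)

definition low_polys :: "nat \<Rightarrow> 'a::{field,finite} poly set" where
  "low_polys d = {z. z \<noteq> 0 \<and> degree z < d}"

text \<open>Each nonzero polynomial is uniquely a constant, its leading coefficient, times a monic
  polynomial of the same degree.\<close>

lemma sum_low_polys_monics:
  fixes f :: "'a::{field,finite} poly \<Rightarrow> 'b::comm_monoid_add"
  shows "sum f (low_polys d) = (\<Sum>i<d. \<Sum>m\<in>monics i. \<Sum>c\<in>UNIV - {0}. f (smult c m))"
proof -
  have "sum f (low_polys d) = (\<Sum>(i, m, c)\<in>(SIGMA i:{..<d}. monics i \<times> (UNIV - {0})). f (smult c m))"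
    by (rule sum.reindex_bij_witness[of _ "\<lambda>(i, m, c). smult c m"
          "\<lambda>z. (degree z, smult (inverse (lead_coeff z)) z, lead_coeff z)"])
       (auto simp: low_polys_def monics_def)
  also have "\<dots> = (\<Sum>i<d. \<Sum>m\<in>monics i. \<Sum>c\<in>UNIV - {0}. f (smult c m))"
    by (subst sum.Sigma[symmetric]) (auto simp: finite_monics sum.cartesian_product)
  finally show ?thesis .
qed

lemma sum_low_polys_inverse_power:
  "(\<Sum>z\<in>low_polys d. inverse (to_fract z) ^ k) =
     (if CARD('a) - 1 dvd k then - (\<Sum>i<d. S i (int k)) else 0 :: 'a::{field,finite} poly fract)"
proof -
  have const: "inverse (to_fract [:c:]) = to_fract [:inverse c:]" if "c \<noteq> 0" for c :: 'a
    using that by (intro inverse_unique) (simp flip: to_fract_mult to_fract_1 add: one_pCons)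
  have sum_const: "(\<Sum>c\<in>B. to_fract [:g c:]) = to_fract [:sum g B:]" for B and g :: "'a \<Rightarrow> 'a"
    by (induction B rule: infinite_finite_induct) (simp_all flip: to_fract_add)
  have split: "inverse (to_fract (smult c m)) ^ k =
      to_fract [:inverse c ^ k:] * inverse (to_fract m) ^ k" if "c \<noteq> 0" for c and m :: "'a poly"
  proof -
    have "to_fract (smult c m) = to_fract [:c:] * to_fract m"
      by (simp flip: to_fract_mult)
    then show ?thesis
      using const[OF that]
      by (simp add: power_mult_distrib poly_const_pow flip: to_fract_power)
  qed
  \<comment> \<open>Inversion permutes the nonzero constants, which reduces negative powers to the
    sum already evaluated.\<close>
  have "(\<Sum>c\<in>UNIV - {0::'a}. inverse c ^ k) = (\<Sum>c\<in>UNIV - {0}. c ^ k)"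
    by (rule sum.reindex_bij_witness[of _ inverse inverse]) auto
  then have "(\<Sum>c\<in>UNIV - {0::'a}. to_fract [:inverse c ^ k:]) =
      to_fract [:if CARD('a) - 1 dvd k then -1 else 0:]"
    using sum_const[of "\<lambda>c. inverse c ^ k"] by (simp add: sum_nonzero_powers_finite_field)
  then have *: "(\<Sum>c\<in>UNIV - {0::'a}. to_fract [:inverse c ^ k:]) =
      (if CARD('a) - 1 dvd k then -1 else 0)"
    by (auto simp flip: to_fract_1 to_fract_uminus simp: one_pCons)
  have "(\<Sum>z\<in>low_polys d. inverse (to_fract z) ^ k) =
      (\<Sum>i<d. \<Sum>m\<in>monics i. \<Sum>c\<in>UNIV - {0::'a}. to_fract [:inverse c ^ k:] * inverse (to_fract m) ^ k)"
    unfolding sum_low_polys_monics by (intro sum.cong refl) (simp add: split)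
  also have "\<dots> = (\<Sum>c\<in>UNIV - {0::'a}. to_fract [:inverse c ^ k:]) * (\<Sum>i<d. S i (int k))"
    by (simp add: S_of_nat sum_distrib_left sum_distrib_right)
  finally show ?thesis
    by (simp add: *)
qed

section \<open>Pairs of distinct monic polynomials of equal degree\<close>

definition monic_pairs :: "nat \<Rightarrow> ('a::{field,finite} poly \<times> 'a poly) set" where
  "monic_pairs d = {(x, y). x \<in> monics d \<and> y \<in> monics d \<and> x \<noteq> y}"

lemma monic_add_low_poly: "y \<in> monics d \<Longrightarrow> z \<in> low_polys d \<Longrightarrow> y + z \<in> monics d"
  by (auto simp: monics_def low_polys_def degree_add_eq_left coeff_eq_0)

lemma monic_diff_low_poly: "x \<in> monics d \<Longrightarrow> z \<in> low_polys d \<Longrightarrow> x - z \<in> monics d"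
  using monic_add_low_poly[of x d "- z"] by (simp add: low_polys_def)

lemma monic_diff_monic:
  assumes "(x, y) \<in> monic_pairs d"
  shows "x - y \<in> low_polys d"
proof -
  have xy: "x \<noteq> y" "degree x = d" "degree y = d" "coeff x d = 1" "coeff y d = 1"
    using assms by (auto simp: monic_pairs_def monics_def)
  have "degree (x - y) \<le> d"
    using xy by (simp add: degree_diff_le)
  moreover have "coeff (x - y) d = 0"
    using xy by simp
  ultimately have "degree (x - y) < d"
    using xy(1) by (metis eq_iff_diff_eq_0 le_neq_implies_less leading_coeff_0_iff)
  then show ?thesis
    using xy by (simp add: low_polys_def)
qed

text \<open>The map \<open>(x, y) \<mapsto> (x, x - y)\<close> is a bijection from the pairs onto
  \<open>monics d \<times> low_polys d\<close>, so the sum factors.\<close>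

lemma sum_monic_pairs_fst:
  fixes f :: "'a::{field,finite} poly \<Rightarrow> 'b::comm_semiring_0"
  shows "(\<Sum>(x, y)\<in>monic_pairs d. f x * g (x - y)) = sum f (monics d) * sum g (low_polys d)"
proof -
  have "(\<Sum>(x, y)\<in>monic_pairs d. f x * g (x - y)) = (\<Sum>(x, z)\<in>monics d \<times> low_polys d. f x * g z)"
    by (rule sum.reindex_bij_witness[of _ "\<lambda>(x, z). (x, x - z)" "\<lambda>(x, y). (x, x - y)"])
       (auto intro: monic_diff_low_poly monic_diff_monic, auto simp: monic_pairs_def low_polys_def
         intro: monic_diff_low_poly)
  then show ?thesis
    by (simp add: sum_product sum.cartesian_product)
qed

lemma sum_monic_pairs_snd:
  fixes f :: "'a::{field,finite} poly \<Rightarrow> 'b::comm_semiring_0"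
  shows "(\<Sum>(x, y)\<in>monic_pairs d. f y * g (x - y)) = sum f (monics d) * sum g (low_polys d)"
proof -
  have "(\<Sum>(x, y)\<in>monic_pairs d. f y * g (x - y)) = (\<Sum>(y, z)\<in>monics d \<times> low_polys d. f y * g z)"
    by (rule sum.reindex_bij_witness[of _ "\<lambda>(y, z). (y + z, y)" "\<lambda>(x, y). (y, x - y)"])
       (auto intro: monic_add_low_poly monic_diff_monic, auto simp: monic_pairs_def low_polys_def
         intro: monic_add_low_poly)
  then show ?thesis
    by (simp add: sum_product sum.cartesian_product)
qed

text \<open>In the product of the two power sums, the diagonal contributes exactly the subtracted
  power sum of exponent \<open>a + b\<close>.\<close>

lemma \<Delta>_of_nat:
  "\<Delta> d (int a) (int b) =
     (\<Sum>(x, y)\<in>monic_pairs d. inverse (to_fract x) ^ a * inverse (to_fract y) ^ b)"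
proof -
  let ?f = "\<lambda>(x, y). inverse (to_fract x) ^ a * inverse (to_fract y) ^ b"
  let ?D = "(\<lambda>x. (x, x)) ` monics d"
  have "S d (int a) * S d (int b) = sum ?f (monics d \<times> monics d)"
    by (simp add: S_of_nat sum_product sum.cartesian_product)
  also have "monics d \<times> monics d = monic_pairs d \<union> ?D"
    by (auto simp: monic_pairs_def)
  also have "sum ?f \<dots> = sum ?f (monic_pairs d) + sum ?f ?D"
  proof (rule sum.union_disjoint)
    show "finite (monic_pairs d)"
      by (rule finite_subset[of _ "monics d \<times> monics d"])
         (auto simp: monic_pairs_def finite_monics)
  qed (auto simp: monic_pairs_def finite_monics)
  also have "sum ?f ?D = S d (int (a + b))"
    unfolding S_of_nat by (simp add: sum.reindex inj_on_def power_add)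
  finally show ?thesis
    by (simp add: \<Delta>_def diff_eq_eq)
qed

section \<open>Partial fractions\<close>

lemma sum_from_1_split:
  fixes g :: "nat \<Rightarrow> 'b::comm_monoid_add"
  assumes "n \<ge> 1"
  shows "(\<Sum>u=1..n. g u) = g 1 + (\<Sum>u=2..n. g u)"
  using sum.atLeast_Suc_atMost[of 1 n g] assms by (simp add: numeral_2_eq_2)

text \<open>The hypothesis is what \<open>x = y + z\<close> becomes for the inverses
  \<open>X\<close>, \<open>Y\<close>, \<open>W\<close> of \<open>x\<close>, \<open>y\<close>,
  \<open>z\<close>. Each further factor \<open>X\<close> turns \<open>X * Y\<close> into
  \<open>W * Y - W * X\<close> and so splits off one more term free of \<open>Y\<close>.\<close>

lemma power_mult_partial_fractions:
  fixes X Y W :: "'b::comm_ring_1"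
  assumes "X * Y = W * (Y - X)"
  shows "X ^ N * Y = W ^ N * Y - (\<Sum>u=1..N. X ^ u * W ^ (N + 1 - u))"
proof (induction N)
  case (Suc N)
  have "X ^ Suc N * Y = X * (X ^ N * Y)"
    by (simp add: mult_ac)
  also have "\<dots> = W ^ N * (X * Y) - X * (\<Sum>u=1..N. X ^ u * W ^ (N + 1 - u))"
    unfolding Suc.IH by (simp only: right_diff_distrib mult_ac)
  also have "X * (\<Sum>u=1..N. X ^ u * W ^ (N + 1 - u)) = (\<Sum>u=2..Suc N. X ^ u * W ^ (Suc N + 1 - u))"
    unfolding sum_distrib_left
    by (rule sum.reindex_bij_witness[of _ "\<lambda>u. u - 1" Suc]) (auto simp: mult_ac)
  also have "W ^ N * (X * Y) = W ^ Suc N * Y - X ^ 1 * W ^ (Suc N + 1 - 1)"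
    by (simp add: assms algebra_simps)
  finally show ?case
    by (simp only: sum_from_1_split[of "Suc N", OF Suc_le_mono[THEN iffD2, OF le0, folded One_nat_def]] diff_diff_eq)
qed simp

text \<open>The left side is \<open>x * Y\<close> times \<open>X ^ Q * Y ^ Q\<close>. By
  \<open>xQ\<close> the second factor splits into two terms only, and
  \<open>x * Y = 1 + z * Y\<close>. The one mixed term left in \<open>X\<close> and \<open>Y\<close>
  is \<open>X ^ (Q - 1) * Y\<close>, which \<open>power_mult_partial_fractions\<close>
  decomposes.\<close>

lemma partial_fractions_freshmans_dream:
  fixes x y z :: "'b::field"
  assumes nz: "x \<noteq> 0" "y \<noteq> 0" "z \<noteq> 0" and x: "x = y + z" and xQ: "x ^ Q = y ^ Q + z ^ Q"
    and Q: "Q \<ge> 2"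
  defines "X \<equiv> inverse x" and "Y \<equiv> inverse y" and "W \<equiv> inverse z"
  shows "X ^ (Q - 1) * Y ^ (Q + 1) =
    Y ^ Q * W ^ Q + Y ^ (Q + 1) * W ^ (Q - 1) - Y * W ^ (2 * Q - 1)
    + (\<Sum>u=1..Q-1. X ^ u * W ^ (2 * Q - u))"
proof -
  obtain N where N: "Q = Suc N"
    using Q by (cases Q) auto
  have inv: "X * x = 1" "W * z = 1"
    using nz by (simp_all add: X_def W_def)
  \<comment> \<open>Needed twice: for \<open>x\<close>, \<open>y\<close>, \<open>z\<close> and for
    their \<open>Q\<close>-th powers.\<close>
  have diff: "inverse a * inverse b = inverse c * (inverse b - inverse a)"
    if "a \<noteq> 0" "b \<noteq> 0" "c \<noteq> 0" "a = b + c" for a b c :: 'b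
    using that(1-3) by (simp add: field_simps that(4))
  have 1: "X * Y = W * (Y - X)"
    unfolding X_def Y_def W_def by (rule diff[OF nz x])
  have 2: "X ^ Q * Y ^ Q = W ^ Q * (Y ^ Q - X ^ Q)"
    unfolding X_def Y_def W_def power_inverse by (rule diff) (use nz xQ in auto)
  have xY: "x * Y = 1 + z * Y"
    using nz by (simp add: x Y_def field_simps)
  have "2 * Q - 1 = N + Q"
    by (simp add: N)
  then have W: "W ^ (2 * Q - 1) = W ^ N * W ^ Q"
    by (simp only: power_add)
  have "X ^ (Q - 1) * Y ^ (Q + 1) = (X * x) * X ^ N * Y ^ (Q + 1)"
    by (simp add: inv N)
  also have "\<dots> = x * Y * (X ^ Q * Y ^ Q)"
    by (simp add: N mult_ac)
  also have "\<dots> = x * Y * Y ^ Q * W ^ Q - (X * x) * (X ^ N * Y) * W ^ Q"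
    unfolding 2 by (simp add: N algebra_simps)
  \<comment> \<open>The factor \<open>z\<close> coming from \<open>x * Y\<close> is absorbed by
    \<open>W * z = 1\<close>, which lowers \<open>W ^ Q\<close> to
    \<open>W ^ (Q - 1)\<close>.\<close>
  also have "\<dots> = Y ^ Q * W ^ Q + Y ^ (Q + 1) * W ^ N * (W * z) - X ^ N * Y * W ^ Q"
    unfolding xY inv by (simp add: N inv algebra_simps)
  also have "X ^ N * Y * W ^ Q =
      Y * W ^ (2 * Q - 1) - (\<Sum>u=1..N. X ^ u * W ^ (N + 1 - u)) * W ^ Q"
    unfolding power_mult_partial_fractions[OF 1] left_diff_distrib W by (simp only: mult_ac)
  also have "(\<Sum>u=1..N. X ^ u * W ^ (N + 1 - u)) * W ^ Q = (\<Sum>u=1..Q-1. X ^ u * W ^ (2 * Q - u))"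
    unfolding sum_distrib_right
  proof (rule sum.cong)
    fix u assume "u \<in> {1..Q-1}"
    then have "2 * Q - u = (N + 1 - u) + Q"
      by (auto simp: N)
    then show "X ^ u * W ^ (N + 1 - u) * W ^ Q = X ^ u * W ^ (2 * Q - u)"
      by (simp add: power_add mult.assoc)
  qed (simp add: N)
  finally show ?thesis
    by (simp add: inv N)
qed

text \<open>Every partial fraction involves \<open>x - y\<close> and only one of \<open>x\<close>
  and \<open>y\<close>, so its sum over the pairs is a product of two independent sums.\<close>

lemma \<Delta>_eq_sum_low_polys:
  assumes Q: "Q \<ge> 2" and dream: "\<And>x y :: 'a::{field,finite} poly. (x + y) ^ Q = x ^ Q + y ^ Q"
  shows "\<Delta> d (int (Q - 1)) (int (Q + 1)) =
    (\<Sum>u=2..Q+1. S d (int u) * (\<Sum>z\<in>low_polys d. inverse (to_fract (z :: 'a poly)) ^ (2 * Q - u)))"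
proof -
  define R where "R = (\<lambda>a :: 'a poly. inverse (to_fract a))"
  define T where "T = (\<lambda>k. \<Sum>z\<in>low_polys d. R z ^ k)"
  have pair: "R x ^ (Q - 1) * R y ^ (Q + 1) =
    R y ^ Q * R (x - y) ^ Q + R y ^ (Q + 1) * R (x - y) ^ (Q - 1) - R y ^ 1 * R (x - y) ^ (2 * Q - 1)
    + (\<Sum>u=1..Q-1. R x ^ u * R (x - y) ^ (2 * Q - u))" if "(x, y) \<in> monic_pairs d" for x y
  proof -
    have nz: "x \<noteq> 0" "y \<noteq> 0" "x - y \<noteq> 0"
      using that by (auto simp: monic_pairs_def monics_def)
    have "x ^ Q = y ^ Q + (x - y) ^ Q"
      using dream[of y "x - y"] by simp
    then have "to_fract x ^ Q = to_fract y ^ Q + to_fract (x - y) ^ Q"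
      by (simp only: to_fract_power[symmetric] to_fract_add[symmetric])
    then show ?thesis
      using nz Q unfolding R_def power_one_right
      by (intro partial_fractions_freshmans_dream) (simp_all del: to_fract_diff, simp)
  qed
  have fst: "(\<Sum>(x, y)\<in>monic_pairs d. R x ^ u * R (x - y) ^ k) = S d (int u) * T k" for u k
    unfolding sum_monic_pairs_fst[of "\<lambda>x. R x ^ u" "\<lambda>z. R z ^ k"] by (simp add: S_of_nat T_def R_def)
  have snd: "(\<Sum>(x, y)\<in>monic_pairs d. R y ^ u * R (x - y) ^ k) = S d (int u) * T k" for u k
    unfolding sum_monic_pairs_snd[of "\<lambda>x. R x ^ u" "\<lambda>z. R z ^ k"] by (simp add: S_of_nat T_def R_def)
  have "\<Delta> d (int (Q - 1)) (int (Q + 1)) = (\<Sum>(x, y)\<in>monic_pairs d. R x ^ (Q - 1) * R y ^ (Q + 1))"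
    unfolding \<Delta>_of_nat R_def ..
  also have "\<dots> = (\<Sum>(x, y)\<in>monic_pairs d.
      R y ^ Q * R (x - y) ^ Q + R y ^ (Q + 1) * R (x - y) ^ (Q - 1) - R y ^ 1 * R (x - y) ^ (2 * Q - 1)
      + (\<Sum>u=1..Q-1. R x ^ u * R (x - y) ^ (2 * Q - u)))"
    by (intro sum.cong refl) (auto simp only: pair split: prod.split)
  also have "\<dots> = (\<Sum>(x, y)\<in>monic_pairs d. R y ^ Q * R (x - y) ^ Q)
      + (\<Sum>(x, y)\<in>monic_pairs d. R y ^ (Q + 1) * R (x - y) ^ (Q - 1))
      - (\<Sum>(x, y)\<in>monic_pairs d. R y ^ 1 * R (x - y) ^ (2 * Q - 1))
      + (\<Sum>u=1..Q-1. \<Sum>(x, y)\<in>monic_pairs d. R x ^ u * R (x - y) ^ (2 * Q - u))"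
    by (subst sum.swap) (simp add: case_prod_unfold sum.distrib sum_subtractf)
  also have "\<dots> = S d (int Q) * T Q + S d (int (Q + 1)) * T (Q - 1) - S d (int 1) * T (2 * Q - 1)
      + (\<Sum>u=1..Q-1. S d (int u) * T (2 * Q - u))"
    by (simp only: fst snd)
  \<comment> \<open>The subtracted product, which came from \<open>y\<close>, cancels the summand
    \<open>u = 1\<close>, which came from \<open>x\<close>.\<close>
  also have "\<dots> = S d (int Q) * T Q + S d (int (Q + 1)) * T (Q - 1)
      + (\<Sum>u=2..Q-1. S d (int u) * T (2 * Q - u))"
    using Q sum_from_1_split[of "Q - 1" "\<lambda>u. S d (int u) * T (2 * Q - u)"] by simp
  \<comment> \<open>The two separate products are the summands \<open>u = Q\<close> and
    \<open>u = Q + 1\<close>.\<close>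
  also have "\<dots> = (\<Sum>u=2..Q+1. S d (int u) * T (2 * Q - u))"
  proof -
    have "{2..Q+1} = insert (Q + 1) (insert Q {2..Q-1})"
      using Q by auto
    moreover have "2 * Q - Q = Q" "2 * Q - (Q + 1) = Q - 1"
      by simp_all
    moreover have "Q + 1 \<notin> insert Q {2..Q-1}" "Q \<notin> {2..Q-1}"
      using Q by auto
    ultimately show ?thesis
      by (simp only: sum.insert finite_insert finite_atLeastAtMost not_False_eq_True) (simp only: ac_simps)
  qed
  finally show ?thesis
    by (simp add: T_def R_def)
qed

section \<open>Selection of the exponents that survive summation over constants\<close>

theorem theorem3p2:
  fixes p e q n d :: nat
  assumes "prime p" and "e \<ge> 1" and "q = p ^ e"
    and "CARD('a) = q"
    and "n \<ge> 1" and "d \<ge> 1"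
  shows "(\<Delta> d (int q ^ n - 1) (int q ^ n + 1) :: 'a::{field,finite} poly fract) =
    - (\<Sum>j = 1..(q ^ n + q - 2) div (q - 1).
         S2 d (2 + (int j - 1) * (int q - 1)) (2 * int q ^ n - 2 - (int j - 1) * (int q - 1)))"
proof -
  define Q where "Q = q ^ n"
  have prime: "prime CHAR('a)"
    by (rule prime_CHAR_semidom) (simp add: finite_imp_CHAR_pos)
  moreover have "CHAR('a) dvd p ^ e"
    using of_nat_card_finite_field[where ?'a = 'a] assms(3,4) by (simp only: of_nat_eq_0_iff_char_dvd)
  ultimately have "CHAR('a) = p"
    using \<open>prime p\<close> by (metis prime_dvd_power primes_dvd_imp_eq)
  \<comment> \<open>Being a power of the characteristic makes \<open>Q\<close>-th powers
    additive.\<close>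
  then have Qp: "Q = CHAR('a poly) ^ (e * n)"
    by (simp add: Q_def assms(3) power_mult)
  have dream: "(x + y) ^ Q = x ^ Q + y ^ Q" for x y :: "'a poly"
    by (rule freshmans_dream'[OF _ Qp]) (simp add: prime)
  have q: "q \<ge> 2"
    using assms prime_ge_2_nat[of p] self_le_power[of p e] by simp
  have "q \<le> Q"
    unfolding Q_def using q assms(5) self_le_power[of q n] by simp
  with q have Q: "Q \<ge> 2"
    by simp
  have "int q - 1 dvd int q ^ n - 1"
    by (simp add: power_diff_1_eq)
  then have "int (q - 1) dvd int (Q - 1)"
    using q Q by (simp add: Q_def of_nat_diff)
  then obtain M where M: "Q - 1 = (q - 1) * M"
    by (auto simp only: int_dvd_int_iff)
  then have Q_eq: "Q = Suc ((q - 1) * M)"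
    using Q by simp
  have Qq: "Q + q - 2 = (M + 1) * (q - 1)"
    using q by (simp add: Q_eq algebra_simps)
  have N: "(q ^ n + q - 2) div (q - 1) = M + 1"
    unfolding Q_def[symmetric] Qq by (rule nonzero_mult_div_cancel_right) (use q in simp)
  \<comment> \<open>The two exponents add up to \<open>2 * (Q - 1)\<close>, a multiple of
    \<open>q - 1\<close>; since \<open>2 \<le> u \<le> Q + 1 \<le> 2 * Q\<close>, neither
    subtraction is truncated.\<close>
  have dvd_iff: "q - 1 dvd 2 * Q - u \<longleftrightarrow> q - 1 dvd u - 2" if "u \<in> {2..Q+1}" for u
  proof -
    have "(2 * Q - u) + (u - 2) = (q - 1) * (2 * M)"
      using that Q_eq Q by auto
    then show ?thesis
      by (metis dvd_add_left_iff dvd_add_right_iff dvd_triv_left)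
  qed
  let ?f = "\<lambda>u. S d (int u) * (\<Sum>i<d. S i (int (2 * Q - u))) :: 'a poly fract"
  have "int q ^ n - 1 = int (Q - 1)" "int q ^ n + 1 = int (Q + 1)"
    using Q by (simp_all add: Q_def of_nat_diff)
  then have "(\<Delta> d (int q ^ n - 1) (int q ^ n + 1) :: 'a poly fract) =
      (\<Sum>u=2..Q+1. S d (int u) * (if q - 1 dvd 2 * Q - u then - (\<Sum>i<d. S i (int (2 * Q - u))) else 0))"
    by (simp only: \<Delta>_eq_sum_low_polys[OF Q dream] sum_low_polys_inverse_power assms(4))
  also have "\<dots> = (\<Sum>u=2..Q+1. if q - 1 dvd u - 2 then - ?f u else 0)"
    by (intro sum.cong refl) (simp only: dvd_iff split: if_split, simp)
  also have "\<dots> = - sum ?f {u\<in>{2..Q+1}. q - 1 dvd u - 2}"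
    by (subst sum.inter_filter[symmetric]) (simp_all add: sum_negf)
  \<comment> \<open>Since \<open>(q - 1) * M = Q - 1\<close>, the last index
    \<open>j = M + 1\<close> corresponds to \<open>u = Q + 1\<close>.\<close>
  also have "sum ?f {u\<in>{2..Q+1}. q - 1 dvd u - 2} = (\<Sum>j=1..M+1. ?f (2 + (j - 1) * (q - 1)))"
  proof (rule sum.reindex_bij_witness[of _ "\<lambda>j. 2 + (j - 1) * (q - 1)" "\<lambda>u. (u - 2) div (q - 1) + 1"])
    fix u assume u: "u \<in> {u\<in>{2..Q+1}. q - 1 dvd u - 2}"
    then obtain l where l: "u - 2 = (q - 1) * l"
      by auto
    with u have ul: "u = 2 + (q - 1) * l"
      by auto
    show "2 + ((u - 2) div (q - 1) + 1 - 1) * (q - 1) = u"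
      using ul q by simp
    then show "?f (2 + ((u - 2) div (q - 1) + 1 - 1) * (q - 1)) = ?f u"
      by simp
    have "(q - 1) * l \<le> (q - 1) * M"
      using u ul Q_eq by simp
    then show "(u - 2) div (q - 1) + 1 \<in> {1..M+1}"
      using ul q by simp
  next
    fix j assume j: "j \<in> {1..M+1}"
    show "(2 + (j - 1) * (q - 1) - 2) div (q - 1) + 1 = j"
      using j q by simp
    have "(j - 1) * (q - 1) \<le> M * (q - 1)"
      using j by (intro mult_right_mono) auto
    then show "2 + (j - 1) * (q - 1) \<in> {u\<in>{2..Q+1}. q - 1 dvd u - 2}"
      using Q_eq by (simp add: mult.commute)
  qed
  also have "\<dots> = (\<Sum>j = 1..M+1.
      S2 d (2 + (int j - 1) * (int q - 1)) (2 * int q ^ n - 2 - (int j - 1) * (int q - 1)))"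
  proof (rule sum.cong)
    fix j assume j: "j \<in> {1..M+1}"
    \<comment> \<open>This bound keeps the natural subtraction from \<open>2 * Q\<close>
      untruncated, so that it agrees with the integer one.\<close>
    have "(j - 1) * (q - 1) \<le> M * (q - 1)"
      using j by (intro mult_right_mono) auto
    also have "\<dots> = Q - 1"
      using M by (simp only: mult.commute)
    finally have "(j - 1) * (q - 1) + 2 \<le> 2 * Q"
      using Q by linarith
    moreover have "int ((j - 1) * (q - 1)) = (int j - 1) * (int q - 1)"
      using j q by (simp add: of_nat_diff)
    ultimately have "int (2 + (j - 1) * (q - 1)) = 2 + (int j - 1) * (int q - 1)"
      "int (2 * Q - (2 + (j - 1) * (q - 1))) = 2 * int q ^ n - 2 - (int j - 1) * (int q - 1)"
      by (simp_all add: of_nat_diff Q_def)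
    then show "?f (2 + (j - 1) * (q - 1)) =
        S2 d (2 + (int j - 1) * (int q - 1)) (2 * int q ^ n - 2 - (int j - 1) * (int q - 1))"
      unfolding S2_def by (simp only:)
  qed simp
  finally show ?thesis
    unfolding N .
qed

end
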